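(* Let $C\subset[0,1]$ be the standard $\frac13$-Cantor set and let $C'=[0,1]\setminus C$. Then $C'$ is Schwartz equivalent to $N=\bigcup_{n\in\mathbb{N}}(n,n+1)\subset\mathbb{R}$.
   Context: $\mathbb{N}=\{1,2,3,\dots\}$. $\mathcal{S}(\mathbb{R}^n)$ is the usual Fréchet space of real-valued Schwartz functions on $\mathbb{R}^n$. For an open $U\subset\mathbb{R}^n$, $\mathcal{S}(U)$ is the closed subspace of those $f\in\mathcal{S}(\mathbb{R}^n)$ such that $f$ and all its partial derivatives vanish at every point of $\mathbb{R}^n\setminus U$, with the induced Fréchet topology; its elements are regarded (by restriction) as smooth functions on $U$. Two open subsets $U,V\subset\mathbb{R}^n$ are called Schwartz equivalent if there exists a $C^\infty$-diffeomorphism $\phi\colon U\to V$ such that $s\mapsto s\circ\phi$ is an isomorphism of Fréchet spaces $\mathcal{S}(V)\to\mathcal{S}(U)$. *)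

theory Defs
  imports "HOL-Analysis.Analysis"
begin

text \<open>
  Functions live on a Euclidean space \<open>'a\<close> in place of $\mathbb{R}^n$; the basis vectors of
  \<open>Basis\<close> are the coordinate directions (for the type \<open>real\<close>, the single vector \<open>1\<close>).
  An iterated partial derivative is indexed by the list of the directions of differentiation,
  the head being applied last. On smooth functions the order is irrelevant, so lists and
  multi-indices index the same partial derivatives.
\<close>

primrec iter_partial ::
  "'a::euclidean_space list \<Rightarrow> ('a \<Rightarrow> 'b::real_normed_vector) \<Rightarrow> 'a \<Rightarrow> 'b" where
  "iter_partial [] f = f"
| "iter_partial (b # bs) f = (\<lambda>x. frechet_derivative (iter_partial bs f) (at x) b)"

text \<open>
  To be used with \<open>U\<close> open: then all derivatives of \<open>f\<close> at points of \<open>U\<close> depend only on the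
  values of \<open>f\<close> on \<open>U\<close>. Differentiability is total (Frechet) differentiability, so all iterated
  partial derivatives are in particular continuous on \<open>U\<close>.
\<close>

definition smooth_on ::
  "'a::euclidean_space set \<Rightarrow> ('a \<Rightarrow> 'b::real_normed_vector) \<Rightarrow> bool" where
  "smooth_on U f \<longleftrightarrow>
     (\<forall>bs\<in>lists Basis. \<forall>x\<in>U. iter_partial bs f differentiable (at x))"

definition diffeomorphism_between ::
  "'a::euclidean_space set \<Rightarrow> 'a set \<Rightarrow> ('a \<Rightarrow> 'a) \<Rightarrow> bool" where
  "diffeomorphism_between U V \<phi> \<longleftrightarrow>
     bij_betw \<phi> U V \<and> smooth_on U \<phi> \<and> smooth_on V (inv_into U \<phi>)"

text \<open>The function $x^\alpha\, \partial^\beta f(x)$, with \<open>\<beta>\<close> given as a list.\<close>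

definition weighted_partial ::
  "('a::euclidean_space \<Rightarrow> nat) \<Rightarrow> 'a list \<Rightarrow> ('a \<Rightarrow> real) \<Rightarrow> 'a \<Rightarrow> real" where
  "weighted_partial \<alpha> bs f x = (\<Prod>b\<in>Basis. (x \<bullet> b) ^ \<alpha> b) * iter_partial bs f x"

definition schwartz_functions :: "('a::euclidean_space \<Rightarrow> real) set" where
  "schwartz_functions =
     {f. smooth_on UNIV f \<and> (\<forall>\<alpha>. \<forall>bs\<in>lists Basis. bounded (range (weighted_partial \<alpha> bs f)))}"

definition schwartz_seminorm ::
  "('a::euclidean_space \<Rightarrow> nat) \<Rightarrow> 'a list \<Rightarrow> ('a \<Rightarrow> real) \<Rightarrow> real" where
  "schwartz_seminorm \<alpha> bs f = (SUP x. \<bar>weighted_partial \<alpha> bs f x\<bar>)"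

text \<open>
  The locally convex topology defined by the Schwartz seminorms: the open seminorm balls around
  all points form a subbasis.
\<close>

definition schwartz_topology :: "('a::euclidean_space \<Rightarrow> real) topology" where
  "schwartz_topology = topology_generated_by
     {{g \<in> schwartz_functions. schwartz_seminorm \<alpha> bs (\<lambda>x. g x - f x) < e} | f \<alpha> bs e.
        f \<in> schwartz_functions \<and> bs \<in> lists Basis \<and> e > 0}"

text \<open>
  The space $\mathcal{S}(U)$. Its elements are kept as functions on the whole space; they vanish
  outside \<open>U\<close>, so they are determined by their restrictions to \<open>U\<close>.
\<close>

definition schwartz_on :: "'a::euclidean_space set \<Rightarrow> ('a \<Rightarrow> real) set" where
  "schwartz_on U =
     {f \<in> schwartz_functions. \<forall>bs\<in>lists Basis. \<forall>x\<in>-U. iter_partial bs f x = 0}"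

definition schwartz_on_topology :: "'a::euclidean_space set \<Rightarrow> ('a \<Rightarrow> real) topology" where
  "schwartz_on_topology U = subtopology schwartz_topology (schwartz_on U)"

definition frechet_isomorphism ::
  "('a \<Rightarrow> real) topology \<Rightarrow> ('b \<Rightarrow> real) topology \<Rightarrow> (('a \<Rightarrow> real) \<Rightarrow> ('b \<Rightarrow> real)) \<Rightarrow> bool" where
  "frechet_isomorphism X Y T \<longleftrightarrow>
     homeomorphic_map X Y T \<and>
     (\<forall>f\<in>topspace X. \<forall>g\<in>topspace X. \<forall>c d.
        T (\<lambda>x. c * f x + d * g x) = (\<lambda>y. c * T f y + d * T g y))"

text \<open>
  The function $s \circ \phi$ on \<open>U\<close>, extended by zero; this is the only possible element of
  $\mathcal{S}(U)$ with that restriction to \<open>U\<close>.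
\<close>

definition pullback ::
  "'a set \<Rightarrow> ('a \<Rightarrow> 'b) \<Rightarrow> ('b \<Rightarrow> real) \<Rightarrow> 'a \<Rightarrow> real" where
  "pullback U \<phi> s = (\<lambda>x. if x \<in> U then s (\<phi> x) else 0)"

definition schwartz_equivalent :: "'a::euclidean_space set \<Rightarrow> 'a set \<Rightarrow> bool" where
  "schwartz_equivalent U V \<longleftrightarrow>
     open U \<and> open V \<and>
     (\<exists>\<phi>. diffeomorphism_between U V \<phi> \<and>
          frechet_isomorphism (schwartz_on_topology V) (schwartz_on_topology U) (pullback U \<phi>))"

primrec cantor_approx :: "nat \<Rightarrow> real set" where
  "cantor_approx 0 = {0..1}"
| "cantor_approx (Suc n) =
     (\<lambda>x. x / 3) ` cantor_approx n \<union> (\<lambda>x. 2 / 3 + x / 3) ` cantor_approx n"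

definition cantor_set :: "real set" where
  "cantor_set = (\<Inter>n. cantor_approx n)"

end

(*
  The gaps of the Cantor set are indexed so that the k-th gap has length l_k with
  1 / (3 k^2) <= l_k <= 1 / (k + 1), and the diffeomorphism maps it affinely onto (k, k + 1).
  Pulling back a Schwartz function on N multiplies its n-th derivative by l_k^(-n), which grows
  polynomially in k and is absorbed by the rapid decay. Conversely, a function in S(C') is flat
  at the ends of the gaps, so on the k-th gap its n-th derivative is bounded by l_k^p times
  the supremum of its (n + p)-th derivative; this yields the decay in k of its transport to N.
*)

theory Submission
  imports Defs
begin

section \<open>Iterated derivatives on the real line\<close>

text \<open>Between any two gaps of C lies a third, so no bijection onto the intervals of N respects
  the order of the line. The numbering only has to make k and 1 / l_k bound each other polynomially,
  and counting by generation does this: the 2^j gaps of length 3^-(j+1) get the numbers from 2^j to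
  2^(j+1) - 1, whence k + 1 \<le> 2^(j+1) \<le> 3^(j+1) and 3 k^2 \<ge> 3 * 4^j \<ge> 3^(j+1). The
  exponent 2 is an integer above log_2 3. The delicate points are those of C at which gaps
  accumulate: no single affine piece describes the pullback near them. Smoothness there comes from
  bounds on the formal derivatives that are uniform over all pieces, together with their vanishing
  at every endpoint. Both directions are instances of one estimate with the roles of the two
  families exchanged, so the transport is developed for abstract pairs of families.\<close>

abbreviation nderiv :: "nat \<Rightarrow> (real \<Rightarrow> real) \<Rightarrow> real \<Rightarrow> real" where
  "nderiv n f \<equiv> iter_partial (replicate n 1) f"

lemma lists_Basis_real: "lists (Basis :: real set) = range (\<lambda>n. replicate n 1)"
proof
  have "bs = replicate (length bs) 1" if "bs \<in> lists (Basis :: real set)" for bs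
    using that by (intro replicate_length_same [symmetric]) (auto simp: lists_eq_set)
  then show "lists (Basis :: real set) \<subseteq> range (\<lambda>n. replicate n 1)"
    by blast
qed (auto simp: lists_eq_set)

lemma frechet_derivative_real:
  fixes f :: "real \<Rightarrow> real"
  assumes "(f has_real_derivative D) (at x)"
  shows "frechet_derivative f (at x) 1 = D"
  using frechet_derivative_at [of f "(*) D" x] assms
  by (metis has_field_derivative_def mult.right_neutral)

lemma nderiv_has_derivative:
  assumes "smooth_on U f" "x \<in> U"
  shows "(nderiv n f has_real_derivative nderiv (Suc n) f x) (at x)"
proof -
  have "nderiv n f differentiable (at x)"
    using assms unfolding smooth_on_def lists_Basis_real by simp
  then obtain D where D: "(nderiv n f has_real_derivative D) (at x)"
    by (auto simp: real_differentiable_def)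
  then have "nderiv (Suc n) f x = D"
    by (simp add: frechet_derivative_real)
  with D show ?thesis by simp
qed

text \<open>A guessed sequence \<open>F\<close> in which each term differentiates to the next
  determines all iterated derivatives. Openness of \<open>U\<close> lets agreement on
  \<open>U\<close> pass to the derivatives. Every higher derivative below is identified in this
  way.\<close>

lemma nderiv_eqI:
  assumes "open U" "\<And>x. x \<in> U \<Longrightarrow> f x = F 0 x"
    and "\<And>n x. x \<in> U \<Longrightarrow> (F n has_real_derivative F (Suc n) x) (at x)"
    and "x \<in> U"
  shows "nderiv n f x = F n x"
  using \<open>x \<in> U\<close>
proof (induction n arbitrary: x)
  case (Suc n)
  have "(nderiv n f has_real_derivative F (Suc n) x) (at x)"
    using assms(3) [OF Suc.prems] assms(1) Suc.prems
    by (rule has_field_derivative_transform_within_open) (simp add: Suc.IH)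
  then show ?case
    by (simp add: frechet_derivative_real)
qed (use assms in simp)

lemma smooth_onI:
  assumes "open U" "\<And>x. x \<in> U \<Longrightarrow> f x = F 0 x"
    and "\<And>n x. x \<in> U \<Longrightarrow> (F n has_real_derivative F (Suc n) x) (at x)"
  shows "smooth_on U (f :: real \<Rightarrow> real)"
  unfolding smooth_on_def lists_Basis_real
proof (intro ballI, elim rangeE, clarify)
  fix n x assume x: "x \<in> U"
  have "(nderiv n f has_real_derivative F (Suc n) x) (at x)"
    using assms(3) [OF x] assms(1) x
    by (rule has_field_derivative_transform_within_open) (simp add: nderiv_eqI [OF assms])
  then show "nderiv n f differentiable (at x)"
    by (auto simp: real_differentiable_def)
qed

section \<open>Schwartz functions on the real line\<close>

abbreviation real_seminorm :: "nat \<Rightarrow> nat \<Rightarrow> (real \<Rightarrow> real) \<Rightarrow> real" where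
  "real_seminorm M n \<equiv> schwartz_seminorm (\<lambda>_. M) (replicate n 1)"

lemma weighted_partial_real: "weighted_partial \<alpha> bs f x = x ^ \<alpha> 1 * iter_partial bs f x"
  for x :: real
  by (simp add: weighted_partial_def)

lemma schwartz_seminorm_real:
  "schwartz_seminorm \<alpha> (replicate n 1) f = real_seminorm (\<alpha> 1) n f"
  by (simp add: schwartz_seminorm_def weighted_partial_real)

lemma schwartz_functions_real:
  "f \<in> schwartz_functions \<longleftrightarrow>
     smooth_on UNIV f \<and> (\<forall>M n. \<exists>B. \<forall>x. \<bar>x ^ M * nderiv n f x\<bar> \<le> B)"
proof -
  have "(\<forall>\<alpha>::real \<Rightarrow> nat. P (\<alpha> 1)) \<longleftrightarrow> (\<forall>M. P M)" for P
    by (auto dest: spec [where x = "\<lambda>_. _"])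
  from this [of "\<lambda>M. \<forall>n. \<exists>B. \<forall>x. \<bar>x ^ M * nderiv n f x\<bar> \<le> B"] show ?thesis
    unfolding schwartz_functions_def lists_Basis_real bounded_iff
    by (simp add: weighted_partial_real)
qed

lemma schwartz_has_derivative:
  assumes "f \<in> schwartz_functions"
  shows "(nderiv n f has_real_derivative nderiv (Suc n) f x) (at x)"
  using assms nderiv_has_derivative [of UNIV f x n] by (simp add: schwartz_functions_real)

lemma schwartz_seminorm_upper:
  assumes "f \<in> schwartz_functions"
  shows "\<bar>x ^ M * nderiv n f x\<bar> \<le> real_seminorm M n f"
proof -
  have "\<exists>B. \<forall>x. \<bar>x ^ M * nderiv n f x\<bar> \<le> B"
    using assms unfolding schwartz_functions_real by blast
  then obtain B where "\<forall>x. \<bar>x ^ M * nderiv n f x\<bar> \<le> B" ..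
  then show ?thesis
    unfolding schwartz_seminorm_def weighted_partial_real
    by (intro cSUP_upper2 [where x = x]) (auto intro!: bdd_aboveI2)
qed

lemma schwartz_seminorm_leI:
  assumes "\<And>x. \<bar>x ^ M * nderiv n f x\<bar> \<le> B"
  shows "real_seminorm M n f \<le> B"
  unfolding schwartz_seminorm_def weighted_partial_real
  using assms by (intro cSUP_least) auto

lemma schwartz_seminorm_nonneg:
  assumes "f \<in> schwartz_functions"
  shows "0 \<le> real_seminorm M n f"
  using schwartz_seminorm_upper [OF assms, of 0 M n] by linarith

lemma nderiv_linear:
  assumes "f \<in> schwartz_functions" "g \<in> schwartz_functions"
  shows "nderiv n (\<lambda>x. c * f x + d * g x) x = c * nderiv n f x + d * nderiv n g x"
  by (rule nderiv_eqI [where U = UNIV and F = "\<lambda>n x. c * nderiv n f x + d * nderiv n g x"])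
     (auto intro!: derivative_eq_intros schwartz_has_derivative assms simp del: replicate_Suc)

lemma schwartz_functions_linear:
  assumes "f \<in> schwartz_functions" "g \<in> schwartz_functions"
  shows "(\<lambda>x::real. c * f x + d * g x) \<in> schwartz_functions"
  unfolding schwartz_functions_real
proof (intro conjI allI)
  show "smooth_on UNIV (\<lambda>x. c * f x + d * g x)"
    by (rule smooth_onI [where F = "\<lambda>n x. c * nderiv n f x + d * nderiv n g x"])
       (auto intro!: derivative_eq_intros schwartz_has_derivative assms simp del: replicate_Suc)
  fix M n
  have "\<bar>x ^ M * nderiv n (\<lambda>x. c * f x + d * g x) x\<bar>
      \<le> \<bar>c\<bar> * real_seminorm M n f + \<bar>d\<bar> * real_seminorm M n g" for x
  proof -
    have "\<bar>x ^ M * nderiv n (\<lambda>x. c * f x + d * g x) x\<bar>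
        = \<bar>c * (x ^ M * nderiv n f x) + d * (x ^ M * nderiv n g x)\<bar>"
      by (simp add: nderiv_linear assms algebra_simps)
    also have "\<dots> \<le> \<bar>c\<bar> * \<bar>x ^ M * nderiv n f x\<bar> + \<bar>d\<bar> * \<bar>x ^ M * nderiv n g x\<bar>"
      by (metis abs_mult abs_triangle_ineq)
    also have "\<dots> \<le> \<bar>c\<bar> * real_seminorm M n f + \<bar>d\<bar> * real_seminorm M n g"
      by (intro add_mono mult_left_mono schwartz_seminorm_upper assms) auto
    finally show ?thesis .
  qed
  then show "\<exists>B. \<forall>x. \<bar>x ^ M * nderiv n (\<lambda>x. c * f x + d * g x) x\<bar> \<le> B"
    by blast
qed

lemma nderiv_diff:
  assumes "f \<in> schwartz_functions" "g \<in> schwartz_functions"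
  shows "nderiv n (\<lambda>x. f x - g x) x = nderiv n f x - nderiv n g x"
  using nderiv_linear [OF assms, of n 1 "-1" x] by simp

lemma schwartz_functions_diff:
  assumes "f \<in> schwartz_functions" "g \<in> schwartz_functions"
  shows "(\<lambda>x::real. f x - g x) \<in> schwartz_functions"
  using schwartz_functions_linear [OF assms, of 1 "-1"] by simp

lemma schwartz_seminorm_triangle:
  assumes "f \<in> schwartz_functions" "g \<in> schwartz_functions" "h \<in> schwartz_functions"
  shows "real_seminorm M n (\<lambda>x. f x - h x)
    \<le> real_seminorm M n (\<lambda>x. f x - g x) + real_seminorm M n (\<lambda>x. g x - h x)"
proof (rule schwartz_seminorm_leI)
  fix x
  have "\<bar>x ^ M * nderiv n (\<lambda>x. f x - h x) x\<bar>
      = \<bar>x ^ M * nderiv n (\<lambda>x. f x - g x) x + x ^ M * nderiv n (\<lambda>x. g x - h x) x\<bar>"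
    by (simp add: nderiv_diff assms algebra_simps)
  also have "\<dots> \<le> real_seminorm M n (\<lambda>x. f x - g x) + real_seminorm M n (\<lambda>x. g x - h x)"
    by (intro order.trans [OF abs_triangle_ineq] add_mono schwartz_seminorm_upper
        schwartz_functions_diff assms)
  finally show "\<bar>x ^ M * nderiv n (\<lambda>x. f x - h x) x\<bar> \<le> \<dots>" .
qed

lemma schwartz_seminorm_zero: "real_seminorm M n (\<lambda>x. 0) = 0"
proof -
  have "nderiv n (\<lambda>x. 0) x = 0" for x
    by (rule nderiv_eqI [where U = UNIV and F = "\<lambda>_ _. 0"]) auto
  then show ?thesis
    by (simp add: schwartz_seminorm_def weighted_partial_real)
qed

lemma schwartz_on_real:
  "f \<in> schwartz_on (U :: real set) \<longleftrightarrow> f \<in> schwartz_functions \<and> (\<forall>n. \<forall>x\<in>-U. nderiv n f x = 0)"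
  unfolding schwartz_on_def lists_Basis_real by simp

lemma schwartz_on_diff:
  assumes "f \<in> schwartz_on U" "g \<in> schwartz_on U"
  shows "(\<lambda>x::real. f x - g x) \<in> schwartz_on U"
  using assms by (auto simp: schwartz_on_real schwartz_functions_diff nderiv_diff)

section \<open>The Schwartz topology and a continuity criterion\<close>

lemma openin_schwartz_ball:
  fixes f :: "real \<Rightarrow> real"
  assumes "f \<in> schwartz_functions" "0 < e"
  shows "openin schwartz_topology
    {g \<in> schwartz_functions. real_seminorm M n (\<lambda>x. g x - f x) < e}"
proof -
  have "replicate n 1 \<in> lists (Basis :: real set)"
    unfolding lists_Basis_real by (rule rangeI)
  with assms show ?thesis
    unfolding schwartz_topology_def by (intro topology_generated_by_Basis) blast
qed

lemma topspace_schwartz_topology: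
  "topspace (schwartz_topology :: (real \<Rightarrow> real) topology) = schwartz_functions"
proof
  show "topspace schwartz_topology \<subseteq> (schwartz_functions :: (real \<Rightarrow> real) set)"
    unfolding schwartz_topology_def topology_generated_by_topspace by blast
  show "schwartz_functions \<subseteq> topspace (schwartz_topology :: (real \<Rightarrow> real) topology)"
  proof
    fix f :: "real \<Rightarrow> real" assume f: "f \<in> schwartz_functions"
    show "f \<in> topspace schwartz_topology"
      using openin_subset [OF openin_schwartz_ball [OF f zero_less_one, of 0 0]] f
        schwartz_seminorm_zero [of 0 0] by auto
  qed
qed

lemma topspace_schwartz_on_topology:
  "topspace (schwartz_on_topology U) = (schwartz_on U :: (real \<Rightarrow> real) set)"
  by (auto simp: schwartz_on_topology_def topspace_schwartz_topology schwartz_on_def)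

text \<open>For a difference-preserving map, seminorm bounds give continuity at every point. Two
  seminorms are allowed on the right because pullbacks produce two: one with a larger weight, one of
  higher order from flatness.\<close>

lemma continuous_map_schwartz_onI:
  fixes T :: "(real \<Rightarrow> real) \<Rightarrow> real \<Rightarrow> real"
  assumes maps: "\<And>f. f \<in> schwartz_on V \<Longrightarrow> T f \<in> schwartz_on U"
    and diff: "\<And>f g. T (\<lambda>x. f x - g x) = (\<lambda>x. T f x - T g x)"
    and bound: "\<And>M n. \<exists>C N p q. \<forall>f\<in>schwartz_on V.
      real_seminorm M n (T f) \<le> C * (real_seminorm N n f + real_seminorm p q f)"
  shows "continuous_map (schwartz_on_topology V) (schwartz_on_topology U) T"
proof -
  have sub: "f \<in> schwartz_on W \<Longrightarrow> f \<in> schwartz_functions" for W f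
    by (simp add: schwartz_on_def)
  note T_schwartz = sub [OF maps]
  \<comment> \<open>The centre \<open>f0\<close> ranges over all Schwartz functions: the subbasic
    balls of the ambient topology need not be centred in the image of \<open>T\<close>.\<close>
  have opn: "openin (schwartz_on_topology V)
      {f \<in> schwartz_on V. real_seminorm M n (\<lambda>x. T f x - f0 x) < e}"
    if f0: "f0 \<in> schwartz_functions" for f0 M n e
  proof (subst openin_subopen, clarify)
    fix h assume h: "h \<in> schwartz_on V" and he: "real_seminorm M n (\<lambda>x. T h x - f0 x) < e"
    obtain C N p q where C: "\<forall>f\<in>schwartz_on V.
        real_seminorm M n (T f) \<le> C * (real_seminorm N n f + real_seminorm p q f)"
      using bound [of M n] by (elim exE)
    \<comment> \<open>\<open>C\<close> may be zero or negative, whereas \<open>\<delta>\<close>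
      needs a positive divisor. With this choice \<open>K * (\<delta> + \<delta>)\<close> is exactly
      the distance left between the seminorm at \<open>h\<close> and \<open>e\<close>.\<close>
    define K where "K = \<bar>C\<bar> + 1"
    have K: "C \<le> K" "0 < K" by (auto simp: K_def)
    define \<delta> where "\<delta> = (e - real_seminorm M n (\<lambda>x. T h x - f0 x)) / (2 * K)"
    have \<delta>: "0 < \<delta>" using he K by (simp add: \<delta>_def)
    define B where "B = schwartz_on V \<inter>
      ({g \<in> schwartz_functions. real_seminorm N n (\<lambda>x. g x - h x) < \<delta>} \<inter>
       {g \<in> schwartz_functions. real_seminorm p q (\<lambda>x. g x - h x) < \<delta>})"
    have "openin (schwartz_on_topology V) B"
      unfolding schwartz_on_topology_def B_def using sub [OF h] \<delta>
      by (intro openin_subtopology_Int2 openin_Int openin_schwartz_ball)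
    moreover have "h \<in> B"
      using h sub [OF h] \<delta> by (simp add: B_def schwartz_seminorm_zero)
    moreover have "real_seminorm M n (\<lambda>x. T g x - f0 x) < e" if "g \<in> B" for g
    proof -
      have g: "g \<in> schwartz_on V" using that by (simp add: B_def)
      have gh: "(\<lambda>x. g x - h x) \<in> schwartz_on V" using g h by (rule schwartz_on_diff)
      have "real_seminorm M n (\<lambda>x. T g x - T h x)
          \<le> C * (real_seminorm N n (\<lambda>x. g x - h x) + real_seminorm p q (\<lambda>x. g x - h x))"
        using bspec [OF C gh] by (simp add: diff)
      also have "\<dots> \<le> K *
          (real_seminorm N n (\<lambda>x. g x - h x) + real_seminorm p q (\<lambda>x. g x - h x))"
        using sub [OF gh] K
        by (intro mult_right_mono add_nonneg_nonneg schwartz_seminorm_nonneg)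
      also have "\<dots> < K * (\<delta> + \<delta>)"
        using that K by (intro mult_strict_left_mono add_strict_mono) (auto simp: B_def)
      also have "\<dots> = e - real_seminorm M n (\<lambda>x. T h x - f0 x)"
        using K by (simp add: \<delta>_def)
      finally show ?thesis
        using schwartz_seminorm_triangle [of "T g" "T h" f0 M n]
          T_schwartz [OF g] T_schwartz [OF h] f0 by linarith
    qed
    ultimately show "\<exists>B. openin (schwartz_on_topology V) B \<and> h \<in> B \<and>
        B \<subseteq> {f \<in> schwartz_on V. real_seminorm M n (\<lambda>x. T f x - f0 x) < e}"
      by (intro exI [of _ B]) (auto simp: B_def)
  qed
  have "continuous_map (schwartz_on_topology V) schwartz_topology T"
    unfolding schwartz_topology_def
  proof (intro continuous_on_generated_topo)
    fix W :: "(real \<Rightarrow> real) set"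
    assume "W \<in> {{g \<in> schwartz_functions. schwartz_seminorm \<alpha> bs (\<lambda>x. g x - f x) < e} | f \<alpha> bs e.
        f \<in> schwartz_functions \<and> bs \<in> lists Basis \<and> e > 0}"
    then obtain f and \<alpha> :: "real \<Rightarrow> nat" and bs e
      where f: "f \<in> schwartz_functions" and bs: "bs \<in> lists (Basis :: real set)"
        and W_bs: "W = {g \<in> schwartz_functions. schwartz_seminorm \<alpha> bs (\<lambda>x. g x - f x) < e}"
      by blast
    obtain n where "bs = replicate n 1"
      using bs unfolding lists_Basis_real by (rule rangeE)
    then have W: "W = {g \<in> schwartz_functions. real_seminorm (\<alpha> 1) n (\<lambda>x. g x - f x) < e}"
      using W_bs by (simp only: schwartz_seminorm_real [of \<alpha>])
    have "T -` W \<inter> topspace (schwartz_on_topology V)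
        = {g \<in> schwartz_on V. real_seminorm (\<alpha> 1) n (\<lambda>x. T g x - f x) < e}"
      using T_schwartz by (auto simp: W topspace_schwartz_on_topology)
    then show "openin (schwartz_on_topology V) (T -` W \<inter> topspace (schwartz_on_topology V))"
      using opn [OF f] by simp
  next
    have "T ` topspace (schwartz_on_topology V) \<subseteq> topspace schwartz_topology"
      unfolding topspace_schwartz_topology topspace_schwartz_on_topology using T_schwartz by blast
    then show "T ` topspace (schwartz_on_topology V) \<subseteq> \<Union> {{g \<in> schwartz_functions.
        schwartz_seminorm \<alpha> bs (\<lambda>x. g x - f x) < e} | f \<alpha> bs e.
        f \<in> schwartz_functions \<and> bs \<in> lists Basis \<and> e > 0}"
      unfolding schwartz_topology_def topology_generated_by_topspace .
  qed
  then show ?thesis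
    unfolding schwartz_on_topology_def [of U] continuous_map_in_subtopology
    using maps by (auto simp: topspace_schwartz_on_topology)
qed

section \<open>Piecewise affine maps between families of intervals\<close>

definition interval_union :: "'i set \<Rightarrow> ('i \<Rightarrow> real) \<Rightarrow> ('i \<Rightarrow> real) \<Rightarrow> real set" where
  "interval_union I a l = (\<Union>i\<in>I. {a i<..<a i + l i})"

definition interval_index :: "'i set \<Rightarrow> ('i \<Rightarrow> real) \<Rightarrow> ('i \<Rightarrow> real) \<Rightarrow> real \<Rightarrow> 'i" where
  "interval_index I a l x = (THE i. i \<in> I \<and> x \<in> {a i<..<a i + l i})"

definition interval_map ::
  "'i set \<Rightarrow> ('i \<Rightarrow> real) \<Rightarrow> ('i \<Rightarrow> real) \<Rightarrow> ('i \<Rightarrow> real) \<Rightarrow> ('i \<Rightarrow> real) \<Rightarrow> real \<Rightarrow> real" where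
  "interval_map I a l b m x =
     (let i = interval_index I a l x in b i + m i / l i * (x - a i))"

lemma open_interval_union: "open (interval_union I a l)"
  by (auto simp: interval_union_def)

text \<open>Neither an order nor a separation of the intervals is imposed: they may accumulate, as
  the gaps do, or share endpoints, as the intervals of N do.\<close>

locale interval_family =
  fixes I :: "'i set" and a l :: "'i \<Rightarrow> real"
  assumes length_pos: "i \<in> I \<Longrightarrow> 0 < l i"
    and disjoint: "\<lbrakk>i \<in> I; j \<in> I; x \<in> {a i<..<a i + l i}; x \<in> {a j<..<a j + l j}\<rbrakk> \<Longrightarrow> i = j"
begin

lemma interval_index_eq:
  assumes "i \<in> I" "x \<in> {a i<..<a i + l i}"
  shows "interval_index I a l x = i"
  unfolding interval_index_def using assms disjoint by blast

lemma interval_map_eq: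
  assumes "i \<in> I" "x \<in> {a i<..<a i + l i}"
  shows "interval_map I a l b m x = b i + m i / l i * (x - a i)"
  by (simp add: interval_map_def interval_index_eq [OF assms])

text \<open>An open interval containing an endpoint of another one would overlap it next to that
  endpoint. Consequently functions in S(U) are flat at all endpoints.\<close>

lemma endpoints_notin:
  assumes i: "i \<in> I" and e: "e \<in> {a i, a i + l i}"
  shows "e \<notin> interval_union I a l"
proof
  assume "e \<in> interval_union I a l"
  then obtain j where j: "j \<in> I" "a j < e" "e < a j + l j"
    by (auto simp: interval_union_def)
  have l: "0 < l i" using i by (rule length_pos)
  have "\<exists>z. z \<in> {a i<..<a i + l i} \<and> z \<in> {a j<..<a j + l j}"
  proof (cases "e = a i")
    case True
    obtain z where "a i < z" "z < min (a i + l i) (a j + l j)"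
      using dense [of "a i" "min (a i + l i) (a j + l j)"] j l True by auto
    then show ?thesis using j True by (intro exI [of _ z]) auto
  next
    case False
    then have e: "e = a i + l i" using e by simp
    obtain z where "max (a i) (a j) < z" "z < a i + l i"
      using dense [of "max (a i) (a j)" "a i + l i"] j l e by auto
    then show ?thesis using j e by (intro exI [of _ z]) auto
  qed
  then have "i = j" using disjoint i j by blast
  with j e show False by auto
qed

text \<open>All derivatives vanish at \<open>a i\<close>, so the mean value inequality from there
  trades one more derivative for one more factor \<open>l i\<close>; hence the induction on
  \<open>p\<close> with \<open>n\<close> and \<open>x\<close> arbitrary.\<close>

lemma schwartz_on_flat:
  assumes f: "f \<in> schwartz_on (interval_union I a l)" and i: "i \<in> I"
    and x: "x \<in> {a i..a i + l i}"
  shows "\<bar>nderiv n f x\<bar> \<le> l i ^ p * real_seminorm 0 (n + p) f"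
  using x
proof (induction p arbitrary: n x)
  case 0
  then show ?case
    using f schwartz_seminorm_upper [of f x 0 n] by (simp add: schwartz_on_real)
next
  case (Suc p)
  let ?B = "l i ^ p * real_seminorm 0 (Suc n + p) f"
  have l: "0 < l i" using i by (rule length_pos)
  have B: "0 \<le> ?B"
    using f l by (simp add: schwartz_on_real schwartz_seminorm_nonneg del: replicate_Suc)
  have "norm (nderiv n f x - nderiv n f (a i)) \<le> ?B * norm (x - a i)"
  proof (rule field_differentiable_bound [of "{a i..a i + l i}"])
    show "norm (nderiv (Suc n) f z) \<le> ?B" if "z \<in> {a i..a i + l i}" for z
      using Suc.IH [OF that, of "Suc n"] by simp
    show "(nderiv n f has_real_derivative nderiv (Suc n) f z) (at z within {a i..a i + l i})" for z
      using f schwartz_has_derivative has_field_derivative_at_within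
      by (metis schwartz_on_real)
  qed (use Suc.prems l in auto)
  also have "nderiv n f (a i) = 0"
    using f endpoints_notin [OF i, of "a i"] by (simp add: schwartz_on_real)
  also have "?B * norm (x - a i) \<le> ?B * l i"
    using Suc.prems B by (intro mult_left_mono) auto
  finally show ?case
    by (simp add: algebra_simps)
qed

text \<open>
  At a point \<open>x\<close> outside the union, two applications of the mean value inequality on the segment
  from \<open>y\<close> to the endpoint of its interval nearest to \<open>x\<close> give \<open>\<bar>G n y\<bar> \<le> K * \<bar>y - x\<bar>\<^sup>2\<close>.
\<close>

lemma zero_extension_has_derivative:
  fixes G :: "nat \<Rightarrow> real \<Rightarrow> real" and H :: "'i \<Rightarrow> nat \<Rightarrow> real \<Rightarrow> real"
  assumes zero: "\<And>n x. x \<notin> interval_union I a l \<Longrightarrow> G n x = 0"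
    and eq: "\<And>i n x. \<lbrakk>i \<in> I; x \<in> {a i..a i + l i}\<rbrakk> \<Longrightarrow> G n x = H i n x"
    and deriv: "\<And>i n x. i \<in> I \<Longrightarrow> (H i n has_real_derivative H i (Suc n) x) (at x)"
    and bounded: "\<And>n. \<exists>K. \<forall>x. \<bar>G n x\<bar> \<le> K"
  shows "(G n has_real_derivative G (Suc n) x) (at x)"
proof (cases "x \<in> interval_union I a l")
  case True
  then obtain i where i: "i \<in> I" and x: "x \<in> {a i<..<a i + l i}"
    by (auto simp: interval_union_def)
  have "(G n has_real_derivative H i (Suc n) x) (at x)"
    using deriv [OF i] open_greaterThanLessThan x
    by (rule has_field_derivative_transform_within_open) (use eq [OF i] in auto)
  then show ?thesis
    using eq [OF i] x by simp
next
  case False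
  have step: "\<bar>G n y\<bar> \<le> B * \<bar>y - e\<bar>"
    if i: "i \<in> I" and y: "y \<in> {a i..a i + l i}" and e: "e \<in> {a i, a i + l i}"
      and B: "\<And>z. z \<in> closed_segment e y \<Longrightarrow> \<bar>G (Suc n) z\<bar> \<le> B" for i n y e B
  proof -
    have seg: "closed_segment e y \<subseteq> {a i..a i + l i}"
      using y e length_pos [OF i] by (auto simp: closed_segment_eq_real_ivl)
    have "norm (H i n y - H i n e) \<le> B * norm (y - e)"
    proof (rule field_differentiable_bound [of "closed_segment e y"])
      show "norm (H i (Suc n) z) \<le> B" if "z \<in> closed_segment e y" for z
        using B [OF that] eq [OF i, of z] that seg by auto
      show "(H i n has_real_derivative H i (Suc n) z) (at z within closed_segment e y)" for z
        using deriv [OF i] by (rule has_field_derivative_at_within)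
    qed auto
    moreover have "H i n e = 0"
      using zero [OF endpoints_notin [OF i e]] eq [OF i, of e] e length_pos [OF i] by auto
    ultimately show ?thesis
      using eq [OF i y] by simp
  qed
  obtain K where K: "\<And>x. \<bar>G (Suc (Suc n)) x\<bar> \<le> K" using bounded by blast
  then have "0 \<le> K" by (meson abs_ge_zero order.trans)
  \<comment> \<open>A linear bound would leave the difference quotient at \<open>x\<close> merely
    bounded; the second power of the distance makes it tend to 0, the value of
    \<open>G (Suc n) x\<close>.\<close>
  have quad: "\<bar>G n y\<bar> \<le> K * \<bar>y - x\<bar> * \<bar>y - x\<bar>" for y
  proof (cases "y \<in> interval_union I a l")
    case True
    then obtain i where i: "i \<in> I" and y: "y \<in> {a i<..<a i + l i}"
      by (auto simp: interval_union_def)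
    have "x \<notin> {a i<..<a i + l i}" using False i by (auto simp: interval_union_def)
    then obtain e where e: "e \<in> {a i, a i + l i}" and near: "\<bar>y - e\<bar> \<le> \<bar>y - x\<bar>"
    proof (cases "x \<le> a i")
      case True
      then show ?thesis using that [of "a i"] y by auto
    next
      case False
      then show ?thesis using that [of "a i + l i"] y \<open>x \<notin> {a i<..<a i + l i}\<close> by auto
    qed
    have "\<bar>G (Suc n) z\<bar> \<le> K * \<bar>y - e\<bar>" if z: "z \<in> closed_segment e y" for z
    proof -
      have "\<bar>G (Suc n) z\<bar> \<le> K * \<bar>z - e\<bar>"
        using i _ e K by (rule step) (use z e y in \<open>auto simp: closed_segment_eq_real_ivl split: if_splits\<close>)
      also have "\<dots> \<le> K * \<bar>y - e\<bar>"
        using z \<open>0 \<le> K\<close> by (intro mult_left_mono) (auto simp: closed_segment_eq_real_ivl split: if_splits)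
      finally show ?thesis .
    qed
    with i y e have "\<bar>G n y\<bar> \<le> K * \<bar>y - e\<bar> * \<bar>y - e\<bar>"
      by (intro step) auto
    also have "\<dots> \<le> K * \<bar>y - x\<bar> * \<bar>y - x\<bar>"
      using near \<open>0 \<le> K\<close> by (intro mult_mono) auto
    finally show ?thesis .
  qed (use zero \<open>0 \<le> K\<close> in simp)
  have "((\<lambda>y. (G n y - G n x) / (y - x)) \<longlongrightarrow> 0) (at x)"
  proof (rule Lim_null_comparison)
    show "\<forall>\<^sub>F y in at x. norm ((G n y - G n x) / (y - x)) \<le> K * \<bar>y - x\<bar>"
      using quad zero [OF False]
      by (intro eventually_at_filter [THEN iffD2] always_eventually) (simp add: divide_le_eq)
    have "((\<lambda>y. K * \<bar>y - x\<bar>) \<longlongrightarrow> K * \<bar>x - x\<bar>) (at x)"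
      by (intro tendsto_intros)
    then show "((\<lambda>y. K * \<bar>y - x\<bar>) \<longlongrightarrow> 0) (at x)" by simp
  qed
  then show ?thesis
    by (simp add: has_field_derivative_iff zero [OF False])
qed

text \<open>Stated for any \<open>f\<close> agreeing with the map on the union, in order to cover
  \<open>inv_into\<close>, which is identified with the inverse interval map only there.\<close>

lemma smooth_on_interval_map:
  assumes "\<And>x. x \<in> interval_union I a l \<Longrightarrow> f x = interval_map I a l b m x"
  shows "smooth_on (interval_union I a l) f"
proof -
  define F where "F n x = (let i = interval_index I a l x in
      if n = 0 then b i + m i / l i * (x - a i) else if n = 1 then m i / l i else 0)"
    for n :: nat and x
  have "f x = F 0 x" if "x \<in> interval_union I a l" for x
    using assms [OF that] by (simp add: F_def interval_map_def)
  moreover have "(F n has_real_derivative F (Suc n) x) (at x)" if "x \<in> interval_union I a l" for n x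
  proof -
    from that obtain i where i: "i \<in> I" and x: "x \<in> {a i<..<a i + l i}"
      by (auto simp: interval_union_def)
    have "((\<lambda>x. if n = 0 then b i + m i / l i * (x - a i) else if n = 1 then m i / l i else 0)
        has_real_derivative F (Suc n) x) (at x)"
      using length_pos [OF i]
      by (auto simp: F_def interval_index_eq [OF i x] intro!: derivative_eq_intros)
    then show ?thesis
      using open_greaterThanLessThan x
      by (rule has_field_derivative_transform_within_open)
        (auto simp: F_def interval_index_eq [OF i])
  qed
  ultimately show ?thesis
    by (rule smooth_onI [OF open_interval_union])
qed

end

text \<open>In \<open>growth\<close>, \<open>\<bar>x\<bar> ^ M\<close> is the Schwartz weight and
  \<open>(m i / l i) ^ n\<close> the chain rule factor of an n-th derivative. They can be paid for
  in two ways: \<open>\<bar>y\<bar> ^ N\<close> by the decay of the function at \<open>y\<close>,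
  \<open>(1 / m i) ^ p\<close> by its flatness at the ends of the interval. The constants may depend
  on \<open>M\<close> and \<open>n\<close>, but not on \<open>i\<close>.\<close>

locale interval_family_pair =
  dom: interval_family I a l + cod: interval_family I b m
  for I :: "'i set" and a l b m +
  assumes growth: "\<exists>C N p. \<forall>i\<in>I. \<forall>x\<in>{a i<..<a i + l i}. \<forall>y\<in>{b i<..<b i + m i}.
    \<bar>x\<bar> ^ M * (m i / l i) ^ n \<le> C * (\<bar>y\<bar> ^ N + (1 / m i) ^ p)"
begin

lemma interval_map_in:
  assumes "i \<in> I" "x \<in> {a i<..<a i + l i}"
  shows "interval_map I a l b m x \<in> {b i<..<b i + m i}"
proof -
  have pos: "0 < l i" "0 < m i" using assms dom.length_pos cod.length_pos by auto
  have "m i * ((x - a i) / l i) < m i * 1"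
    using assms(2) pos by (intro mult_strict_left_mono) auto
  then show ?thesis
    using assms(2) pos by (simp add: dom.interval_map_eq [OF assms])
qed

lemma interval_map_inverse:
  assumes "x \<in> interval_union I a l"
  shows "interval_map I b m a l (interval_map I a l b m x) = x"
proof -
  from assms obtain i where i: "i \<in> I" and x: "x \<in> {a i<..<a i + l i}"
    by (auto simp: interval_union_def)
  have "interval_map I b m a l (interval_map I a l b m x)
      = a i + l i / m i * (interval_map I a l b m x - b i)"
    using i interval_map_in [OF i x] by (rule cod.interval_map_eq)
  also have "\<dots> = x"
    using dom.length_pos [OF i] cod.length_pos [OF i] by (simp add: dom.interval_map_eq [OF i x])
  finally show ?thesis .
qed

lemma interval_map_image:
  assumes "x \<in> interval_union I a l"
  shows "interval_map I a l b m x \<in> interval_union I b m"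
  using assms interval_map_in unfolding interval_union_def by blast

definition pullback_deriv :: "nat \<Rightarrow> (real \<Rightarrow> real) \<Rightarrow> real \<Rightarrow> real" where
  "pullback_deriv n f x = (if x \<in> interval_union I a l
     then let i = interval_index I a l x in (m i / l i) ^ n * nderiv n f (interval_map I a l b m x)
     else 0)"

text \<open>The constants are chosen before \<open>f\<close>, so that the one estimate serves both
  for membership in the Schwartz space and for continuity of the pullback.\<close>

lemma pullback_deriv_bound:
  "\<exists>C N p. \<forall>f\<in>schwartz_on (interval_union I b m). \<forall>x.
     \<bar>x ^ M * pullback_deriv n f x\<bar> \<le> C * (real_seminorm N n f + real_seminorm 0 (n + p) f)"
proof -
  obtain C N p where C: "\<And>i x y. \<lbrakk>i \<in> I; x \<in> {a i<..<a i + l i}; y \<in> {b i<..<b i + m i}\<rbrakk> \<Longrightarrow>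
      \<bar>x\<bar> ^ M * (m i / l i) ^ n \<le> C * (\<bar>y\<bar> ^ N + (1 / m i) ^ p)"
    using growth [of M n] by blast
  have "\<bar>x ^ M * pullback_deriv n f x\<bar>
      \<le> \<bar>C\<bar> * (real_seminorm N n f + real_seminorm 0 (n + p) f)"
    if f: "f \<in> schwartz_on (interval_union I b m)" for f x
  proof (cases "x \<in> interval_union I a l")
    case True
    then obtain i where i: "i \<in> I" and x: "x \<in> {a i<..<a i + l i}"
      by (auto simp: interval_union_def)
    define y where "y = interval_map I a l b m x"
    have y: "y \<in> {b i<..<b i + m i}"
      using interval_map_in [OF i x] by (simp add: y_def)
    have pos: "0 < l i" "0 < m i" using i dom.length_pos cod.length_pos by auto
    have "\<bar>x ^ M * pullback_deriv n f x\<bar> = \<bar>x\<bar> ^ M * (m i / l i) ^ n * \<bar>nderiv n f y\<bar>"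
      using True pos
      by (simp add: pullback_deriv_def dom.interval_index_eq [OF i x] abs_mult power_abs y_def)
    also have "\<dots> \<le> \<bar>C\<bar> * (\<bar>y\<bar> ^ N + (1 / m i) ^ p) * \<bar>nderiv n f y\<bar>"
      using pos
      by (intro mult_right_mono order.trans [OF C [OF i x y]] add_nonneg_nonneg) auto
    also have "\<dots> = \<bar>C\<bar> * (\<bar>y ^ N * nderiv n f y\<bar> + (1 / m i) ^ p * \<bar>nderiv n f y\<bar>)"
      by (simp add: algebra_simps abs_mult power_abs)
    also have "\<dots> \<le> \<bar>C\<bar> * (real_seminorm N n f + real_seminorm 0 (n + p) f)"
    proof (intro mult_left_mono add_mono)
      show "\<bar>y ^ N * nderiv n f y\<bar> \<le> real_seminorm N n f"
        using f by (intro schwartz_seminorm_upper) (simp add: schwartz_on_real)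
      have "\<bar>nderiv n f y\<bar> \<le> m i ^ p * real_seminorm 0 (n + p) f"
        using y by (intro cod.schwartz_on_flat [OF f i]) auto
      then show "(1 / m i) ^ p * \<bar>nderiv n f y\<bar> \<le> real_seminorm 0 (n + p) f"
        using pos by (simp add: power_divide pos_divide_le_eq mult.commute)
    qed auto
    finally show ?thesis .
  next
    case False
    then show ?thesis
      using f by (simp add: pullback_deriv_def schwartz_on_real schwartz_seminorm_nonneg)
  qed
  then show ?thesis by blast
qed

lemma pullback_deriv_bounded:
  assumes "f \<in> schwartz_on (interval_union I b m)"
  shows "\<exists>B. \<forall>x. \<bar>x ^ M * pullback_deriv n f x\<bar> \<le> B"
proof -
  obtain C N p where "\<forall>f\<in>schwartz_on (interval_union I b m). \<forall>x.
     \<bar>x ^ M * pullback_deriv n f x\<bar> \<le> C * (real_seminorm N n f + real_seminorm 0 (n + p) f)"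
    using pullback_deriv_bound [of M n] by (elim exE)
  with assms show ?thesis by blast
qed

lemma pullback_deriv_has_derivative:
  assumes f: "f \<in> schwartz_on (interval_union I b m)"
  shows "(pullback_deriv n f has_real_derivative pullback_deriv (Suc n) f x) (at x)"
proof (rule dom.zero_extension_has_derivative)
  \<comment> \<open>The i-th affine piece is used on the whole line, where \<open>f\<close> is
    smooth, so \<open>?H\<close> is differentiable also at the interval ends.\<close>
  let ?H = "\<lambda>i n x. (m i / l i) ^ n * nderiv n f (b i + m i / l i * (x - a i))"
  have fs: "f \<in> schwartz_functions" using f by (simp add: schwartz_on_real)
  show "pullback_deriv n f x = 0" if "x \<notin> interval_union I a l" for n x
    using that by (simp add: pullback_deriv_def)
  show "pullback_deriv n f x = ?H i n x" if i: "i \<in> I" and x: "x \<in> {a i..a i + l i}" for i n x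
  proof (cases "x \<in> {a i<..<a i + l i}")
    case True
    moreover from True i have "x \<in> interval_union I a l" by (auto simp: interval_union_def)
    ultimately show ?thesis
      by (simp add: pullback_deriv_def dom.interval_index_eq [OF i True] dom.interval_map_eq [OF i True])
  next
    case False
    then have e: "x \<in> {a i, a i + l i}" using x by auto
    \<comment> \<open>Affine pieces send endpoints to endpoints, where \<open>f\<close> is flat;
      thus \<open>?H\<close> agrees with the zero extension on the closed interval.\<close>
    then have "b i + m i / l i * (x - a i) \<in> {b i, b i + m i}"
      using dom.length_pos [OF i] by auto
    then have "nderiv n f (b i + m i / l i * (x - a i)) = 0"
      using f cod.endpoints_notin [OF i] unfolding schwartz_on_real by blast
    then show ?thesis
      using dom.endpoints_notin [OF i e] by (simp add: pullback_deriv_def)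
  qed
  show "(?H i n has_real_derivative ?H i (Suc n) x) (at x)" for i n x
  proof -
    have "((\<lambda>x. b i + m i / l i * (x - a i)) has_real_derivative m i / l i) (at x)"
      by (rule derivative_eq_intros refl | simp)+
    from DERIV_cmult [OF DERIV_chain2 [OF schwartz_has_derivative [OF fs, of n] this],
        of "(m i / l i) ^ n"]
    show ?thesis by (simp only: power_Suc mult_ac)
  qed
  show "\<exists>K. \<forall>x. \<bar>pullback_deriv n f x\<bar> \<le> K" for n
    using pullback_deriv_bounded [OF f, of 0 n] by simp
qed

lemma nderiv_pullback:
  assumes "f \<in> schwartz_on (interval_union I b m)"
  shows "nderiv n (pullback (interval_union I a l) (interval_map I a l b m) f) x
    = pullback_deriv n f x"
  by (rule nderiv_eqI [where U = UNIV and F = "\<lambda>n. pullback_deriv n f"])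
    (auto simp: pullback_def pullback_deriv_def [of 0] Let_def pullback_deriv_has_derivative assms)

lemma pullback_schwartz_on:
  assumes f: "f \<in> schwartz_on (interval_union I b m)"
  shows "pullback (interval_union I a l) (interval_map I a l b m) f
    \<in> schwartz_on (interval_union I a l)"
  unfolding schwartz_on_real schwartz_functions_real nderiv_pullback [OF f]
proof (intro conjI allI ballI)
  show "smooth_on UNIV (pullback (interval_union I a l) (interval_map I a l b m) f)"
    by (rule smooth_onI [where F = "\<lambda>n. pullback_deriv n f"])
      (auto simp: pullback_def pullback_deriv_def [of 0] Let_def pullback_deriv_has_derivative f)
  show "\<exists>B. \<forall>x. \<bar>x ^ M * pullback_deriv n f x\<bar> \<le> B" for M n
    using f by (rule pullback_deriv_bounded)
qed (simp add: pullback_deriv_def)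

lemma continuous_map_pullback:
  "continuous_map (schwartz_on_topology (interval_union I b m))
     (schwartz_on_topology (interval_union I a l))
     (pullback (interval_union I a l) (interval_map I a l b m))"
proof (rule continuous_map_schwartz_onI)
  fix M n
  obtain C N p where "\<forall>f\<in>schwartz_on (interval_union I b m). \<forall>x.
     \<bar>x ^ M * pullback_deriv n f x\<bar> \<le> C * (real_seminorm N n f + real_seminorm 0 (n + p) f)"
    using pullback_deriv_bound [of M n] by (elim exE)
  then show "\<exists>C N p q. \<forall>f\<in>schwartz_on (interval_union I b m).
      real_seminorm M n (pullback (interval_union I a l) (interval_map I a l b m) f)
        \<le> C * (real_seminorm N n f + real_seminorm p q f)"
    by (intro exI [of _ C] exI [of _ N] exI [of _ 0] exI [of _ "n + p"] ballI
        schwartz_seminorm_leI) (simp add: nderiv_pullback)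
next
  show "pullback (interval_union I a l) (interval_map I a l b m) (\<lambda>x. f x - g x) =
    (\<lambda>x. pullback (interval_union I a l) (interval_map I a l b m) f x
      - pullback (interval_union I a l) (interval_map I a l b m) g x)" for f g
    by (auto simp: pullback_def)
qed (rule pullback_schwartz_on)

end

lemma pullback_pullback:
  assumes "f \<in> schwartz_on V" "\<And>y. y \<in> V \<Longrightarrow> \<psi> y \<in> U" "\<And>y. y \<in> V \<Longrightarrow> \<phi> (\<psi> y) = y"
  shows "pullback V \<psi> (pullback U \<phi> f) = f"
proof
  show "pullback V \<psi> (pullback U \<phi> f) y = f y" for y
    \<comment> \<open>Outside \<open>V\<close> the pullback is 0 by definition, and so is
      \<open>f\<close>: the index list \<open>[]\<close> stands for the derivative of order
      0.\<close>
    using assms by (cases "y \<in> V") (auto simp: pullback_def schwartz_on_def dest: bspec [where x = "[]"])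
qed

text \<open>The inverse of the pullback is the pullback along the inverse map; its continuity comes
  from the second hypothesis, without an open mapping theorem.\<close>

theorem schwartz_equivalent_interval_unions:
  assumes ab: "interval_family_pair I a l b m" and ba: "interval_family_pair I b m a l"
  shows "schwartz_equivalent (interval_union I a l) (interval_union I b m)"
proof -
  interpret ab: interval_family_pair I a l b m by (rule ab)
  interpret ba: interval_family_pair I b m a l by (rule ba)
  let ?U = "interval_union I a l" and ?V = "interval_union I b m"
  let ?\<phi> = "interval_map I a l b m" and ?\<psi> = "interval_map I b m a l"
  have bij: "bij_betw ?\<phi> ?U ?V"
    by (rule bij_betw_byWitness [where f' = ?\<psi>])
      (auto simp: ab.interval_map_inverse ba.interval_map_inverse
        ab.interval_map_image ba.interval_map_image)
  have "inv_into ?U ?\<phi> y = ?\<psi> y" if "y \<in> ?V" for y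
    using bij that
    by (metis ba.interval_map_image ba.interval_map_inverse bij_betw_inv_into_left)
  then have "diffeomorphism_between ?U ?V ?\<phi>"
    unfolding diffeomorphism_between_def
    using bij ab.dom.smooth_on_interval_map ab.cod.smooth_on_interval_map by blast
  moreover have "homeomorphic_maps (schwartz_on_topology ?V) (schwartz_on_topology ?U)
      (pullback ?U ?\<phi>) (pullback ?V ?\<psi>)"
    unfolding homeomorphic_maps_def topspace_schwartz_on_topology
    by (auto simp: ab.continuous_map_pullback ba.continuous_map_pullback pullback_pullback
        ab.interval_map_inverse ba.interval_map_inverse ab.interval_map_image ba.interval_map_image)
  then have "frechet_isomorphism (schwartz_on_topology ?V) (schwartz_on_topology ?U)
      (pullback ?U ?\<phi>)"
    unfolding frechet_isomorphism_def
    by (auto dest: homeomorphic_maps_imp_map simp: pullback_def)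
  ultimately show ?thesis
    unfolding schwartz_equivalent_def using open_interval_union by blast
qed

section \<open>The gaps of the Cantor set\<close>

text \<open>
  The gaps are numbered \<open>1, 2, 3, \<dots>\<close> as the nodes of a binary tree: gap \<open>1\<close> is the middle third,
  and gaps \<open>2 * k\<close> and \<open>2 * k + 1\<close> are the images of gap \<open>k\<close> under \<open>x \<mapsto> x / 3\<close> and
  \<open>x \<mapsto> 2 / 3 + x / 3\<close>. Index \<open>0\<close> is junk.
\<close>

fun gap_length :: "nat \<Rightarrow> real" where
  "gap_length k = (if k \<le> 1 then 1 / 3 else gap_length (k div 2) / 3)"

fun gap_start :: "nat \<Rightarrow> real" where
  "gap_start k = (if k \<le> 1 then 1 / 3
     else (if even k then 0 else 2 / 3) + gap_start (k div 2) / 3)"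

declare gap_length.simps [simp del] gap_start.simps [simp del]

lemma gap_simps:
  "gap_length (Suc 0) = 1 / 3" "gap_start (Suc 0) = 1 / 3"
  "1 \<le> k \<Longrightarrow> gap_length (2 * k) = gap_length k / 3"
  "1 \<le> k \<Longrightarrow> gap_length (Suc (2 * k)) = gap_length k / 3"
  "1 \<le> k \<Longrightarrow> gap_start (2 * k) = gap_start k / 3"
  "1 \<le> k \<Longrightarrow> gap_start (Suc (2 * k)) = 2 / 3 + gap_start k / 3"
  by (subst gap_length.simps gap_start.simps; simp)+

lemma binary_tree_induct [consumes 1, case_names one even odd]:
  assumes "1 \<le> k" "P (Suc 0)"
    and "\<And>k. \<lbrakk>1 \<le> k; P k\<rbrakk> \<Longrightarrow> P (2 * k)"
    and "\<And>k. \<lbrakk>1 \<le> k; P k\<rbrakk> \<Longrightarrow> P (Suc (2 * k))"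
  shows "P (k :: nat)"
  using \<open>1 \<le> k\<close>
proof (induction k rule: less_induct)
  case (less k)
  show ?case
  proof (cases "k = 1")
    case False
    then have k: "1 \<le> k div 2" "k div 2 < k" using less.prems by auto
    then have "P (k div 2)" by (intro less.IH)
    then show ?thesis
      using k assms(3,4) [of "k div 2"] by (cases "even k") auto
  qed (use assms in simp)
qed

lemma gap_bounds:
  assumes "1 \<le> k"
  shows "0 < gap_length k \<and> 0 < gap_start k \<and> gap_start k + gap_length k < 1"
  using assms by (induction rule: binary_tree_induct) (auto simp: gap_simps)

text \<open>A child has a third of the length, while \<open>k + 1\<close> at most doubles. The bound
  is for \<open>k + 1\<close> because points of the k-th unit interval come arbitrarily close to
  it.\<close>

lemma gap_length_upper:
  assumes "1 \<le> k"
  shows "(real k + 1) * gap_length k \<le> 1"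
  using assms
proof (induction rule: binary_tree_induct)
  case (even k)
  then show ?case
    using gap_bounds [of k] by (simp only: gap_simps) (simp add: algebra_simps)
next
  case (odd k)
  then show ?case
    using gap_bounds [of k] by (simp only: gap_simps) (simp add: algebra_simps)
qed (simp add: gap_simps)

text \<open>Passing to a child triples the left side and at least quadruples \<open>k ^ 2\<close>.
  The factor 3 gives equality at \<open>k = 1\<close>.\<close>

lemma gap_length_lower:
  assumes "1 \<le> k"
  shows "1 / gap_length k \<le> 3 * real k ^ 2"
  using assms
proof (induction rule: binary_tree_induct)
  case (even k)
  then have "1 / gap_length (2 * k) \<le> 3 * (3 * real k ^ 2)"
    by (simp add: gap_simps)
  also have "\<dots> \<le> 3 * real (2 * k) ^ 2"
    by (simp add: power2_eq_square)
  finally show ?case .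
next
  case (odd k)
  then have "1 / gap_length (Suc (2 * k)) \<le> 3 * (3 * real k ^ 2)"
    by (simp add: gap_simps)
  also have "\<dots> \<le> 3 * real (Suc (2 * k)) ^ 2"
    by (simp add: power2_eq_square algebra_simps)
  finally show ?case .
qed (simp add: gap_simps)

text \<open>Undoes one step of the self-similarity. The position of \<open>x\<close> relative to the
  middle third makes the three cases mutually exclusive.\<close>

lemma gap_cases [consumes 2, case_names middle left right]:
  assumes "1 \<le> k" "x \<in> {gap_start k<..<gap_start k + gap_length k}"
  obtains "k = 1" "x \<in> {1/3<..<2/3}"
  | j where "1 \<le> j" "k = 2 * j" "3 * x \<in> {gap_start j<..<gap_start j + gap_length j}"
      "x < 1/3"
  | j where "1 \<le> j" "k = Suc (2 * j)"
      "3 * x - 2 \<in> {gap_start j<..<gap_start j + gap_length j}" "2/3 < x"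
proof (cases "k = 1")
  case True
  then show ?thesis using that(1) assms by (simp add: gap_simps)
next
  case False
  define j where "j = k div 2"
  have j: "1 \<le> j" using False assms(1) by (auto simp: j_def)
  show ?thesis
  proof (cases "even k")
    case True
    then have "k = 2 * j" by (simp add: j_def)
    then show ?thesis
      using that(2) [of j] j assms(2) gap_bounds [OF j] by (auto simp: gap_simps)
  next
    case False
    then have "k = Suc (2 * j)" by (simp add: j_def)
    then show ?thesis
      using that(3) [of j] j assms(2) gap_bounds [OF j] by (auto simp: gap_simps)
  qed
qed

text \<open>Rescaling by \<open>3 * x\<close> or \<open>3 * x - 2\<close> replaces both gaps by
  their parents; gaps of different cases are separated by position.\<close>

lemma gap_disjoint:
  assumes "1 \<le> k" "1 \<le> k'" "x \<in> {gap_start k<..<gap_start k + gap_length k}"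
    and "x \<in> {gap_start k'<..<gap_start k' + gap_length k'}"
  shows "k = k'"
  using assms
proof (induction k arbitrary: k' x rule: less_induct)
  case (less k)
  from less.prems(1,3) show ?case
  proof (cases rule: gap_cases)
    case middle
    from less.prems(2,4) middle show ?thesis
      by (cases rule: gap_cases) auto
  next
    case (left j)
    from less.prems(2,4) left show ?thesis
      using less.IH [of j] by (cases rule: gap_cases) auto
  next
    case (right j)
    from less.prems(2,4) right show ?thesis
      using less.IH [of j] by (cases rule: gap_cases) auto
  qed
qed

section \<open>The complement of the Cantor set as the union of the gaps\<close>

lemma cantor_approx_subset: "cantor_approx n \<subseteq> {0..1}"
  by (induction n) auto

lemma gap_outside_approx:
  assumes "1 \<le> k" "x \<in> {gap_start k<..<gap_start k + gap_length k}"
  shows "\<exists>n. x \<notin> cantor_approx n"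
  using assms
proof (induction k arbitrary: x rule: less_induct)
  case (less k)
  from less.prems show ?case
  proof (cases rule: gap_cases)
    case middle
    then have "x \<notin> cantor_approx (Suc 0)" by auto
    then show ?thesis ..
  next
    case (left j)
    then obtain n where "3 * x \<notin> cantor_approx n" using less.IH [of j] by auto
    \<comment> \<open>The right-hand copy of \<open>cantor_approx n\<close> starts at 2/3, so only
      the left-hand one could contain \<open>x\<close>.\<close>
    then have "x \<notin> cantor_approx (Suc n)"
      using left cantor_approx_subset [of n] by auto
    then show ?thesis ..
  next
    case (right j)
    then obtain n where "3 * x - 2 \<notin> cantor_approx n" using less.IH [of j] by auto
    then have "x \<notin> cantor_approx (Suc n)"
      using right cantor_approx_subset [of n] by auto
    then show ?thesis ..
  qed
qed

lemma approx_complement_gap: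
  assumes "x \<in> {0..1}" "x \<notin> cantor_approx n"
  shows "x \<in> interval_union {1..} gap_start gap_length"
  using assms
proof (induction n arbitrary: x)
  case (Suc n)
  consider "x \<le> 1/3" | "1/3 < x" "x < 2/3" | "2/3 \<le> x" by linarith
  then show ?case
  proof cases
    case 1
    have "3 * x \<notin> cantor_approx n"
    proof
      assume "3 * x \<in> cantor_approx n"
      then have "3 * x / 3 \<in> cantor_approx (Suc n)" unfolding cantor_approx.simps by blast
      then show False using Suc.prems by simp
    qed
    then obtain k where "1 \<le> k" "3 * x \<in> {gap_start k<..<gap_start k + gap_length k}"
      using Suc.IH [of "3 * x"] 1 Suc.prems by (auto simp: interval_union_def)
    then show ?thesis
      unfolding interval_union_def by (intro UN_I [of "2 * k"]) (auto simp: gap_simps)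
  next
    case 2
    then show ?thesis
      unfolding interval_union_def by (intro UN_I [of "Suc 0"]) (auto simp: gap_simps)
  next
    case 3
    have "3 * x - 2 \<notin> cantor_approx n"
    proof
      assume "3 * x - 2 \<in> cantor_approx n"
      then have "2 / 3 + (3 * x - 2) / 3 \<in> cantor_approx (Suc n)" unfolding cantor_approx.simps by blast
      then show False using Suc.prems by (simp add: field_simps)
    qed
    then obtain k where "1 \<le> k" "3 * x - 2 \<in> {gap_start k<..<gap_start k + gap_length k}"
      using Suc.IH [of "3 * x - 2"] 3 Suc.prems by (auto simp: interval_union_def)
    then show ?thesis
      unfolding interval_union_def by (intro UN_I [of "Suc (2 * k)"]) (auto simp: gap_simps)
  qed
qed auto

lemma cantor_complement:
  "{0..1} - cantor_set = interval_union {1..} gap_start gap_length"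
proof
  show "{0..1} - cantor_set \<subseteq> interval_union {1..} gap_start gap_length"
    unfolding cantor_set_def using approx_complement_gap by blast
  show "interval_union {1..} gap_start gap_length \<subseteq> {0..1} - cantor_set"
  proof
    fix x assume "x \<in> interval_union {1..} gap_start gap_length"
    then obtain k where k: "1 \<le> k" "x \<in> {gap_start k<..<gap_start k + gap_length k}"
      by (auto simp: interval_union_def)
    then show "x \<in> {0..1} - cantor_set"
      using gap_outside_approx [OF k] gap_bounds [OF k(1)] by (auto simp: cantor_set_def)
  qed
qed

section \<open>The growth estimates for gaps and unit intervals\<close>

theorem mainTheorem9:
  shows "schwartz_equivalent ({0..1} - cantor_set) (\<Union>n\<in>{1::nat..}. {real n<..<real n + 1})"
proof -
  interpret gaps: interval_family "{1..}" gap_start gap_length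
    using gap_bounds gap_disjoint by unfold_locales auto
  interpret units: interval_family "{1::nat..}" real "\<lambda>_. 1"
    by unfold_locales auto
  have "interval_family_pair {1..} gap_start gap_length real (\<lambda>_. 1)"
  proof unfold_locales
    fix M n
    \<comment> \<open>The weight is at most 1 on the gaps, and the chain rule factor is paid by
      decay on N alone. The unreduced \<open>(1 / 1) ^ 0\<close> keeps the literal shape of
      \<open>growth\<close>, so that \<open>rule bound\<close> supplies the witnesses by
      unification.\<close>
    have bound: "\<bar>x\<bar> ^ M * (1 / gap_length k) ^ n \<le> 3 ^ n * (\<bar>y\<bar> ^ (2 * n) + (1 / 1) ^ 0)"
      if k: "1 \<le> k" and x: "x \<in> {gap_start k<..<gap_start k + gap_length k}"
        and y: "y \<in> {real k<..<real k + 1}" for k x y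
    proof -
      have "\<bar>x\<bar> ^ M \<le> 1" using gap_bounds [OF k] x by (intro power_le_one) auto
      moreover have "(1 / gap_length k) ^ n \<le> (3 * real k ^ 2) ^ n"
        using gap_length_lower [OF k] gap_bounds [OF k] by (intro power_mono) auto
      ultimately have "\<bar>x\<bar> ^ M * (1 / gap_length k) ^ n \<le> 1 * (3 * real k ^ 2) ^ n"
        using gap_bounds [OF k] by (intro mult_mono) auto
      also have "\<dots> = 3 ^ n * real k ^ (2 * n)"
        by (simp add: power_mult_distrib power_mult)
      also have "\<dots> \<le> 3 ^ n * (\<bar>y\<bar> ^ (2 * n) + (1 / 1) ^ 0)"
        using power_mono [of "real k" "\<bar>y\<bar>" "2 * n"] y by (intro mult_left_mono) auto
      finally show ?thesis .
    qed
    show "\<exists>C N p. \<forall>k\<in>{1..}. \<forall>x\<in>{gap_start k<..<gap_start k + gap_length k}.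
        \<forall>y\<in>{real k<..<real k + 1}.
          \<bar>x\<bar> ^ M * (1 / gap_length k) ^ n \<le> C * (\<bar>y\<bar> ^ N + (1 / 1) ^ p)"
      by (intro exI ballI) (rule bound; simp)
  qed
  moreover have "interval_family_pair {1..} real (\<lambda>_. 1) gap_start gap_length"
  proof unfold_locales
    fix M n
    \<comment> \<open>Now the chain rule factor is at most 1, and the weight at infinity is paid by
      flatness alone, with \<open>p = M\<close>.\<close>
    have bound: "\<bar>x\<bar> ^ M * (gap_length k / 1) ^ n \<le> 1 * (\<bar>y\<bar> ^ 0 + (1 / gap_length k) ^ M)"
      if k: "1 \<le> k" and x: "x \<in> {real k<..<real k + 1}" for k x y
    proof -
      have l: "0 < gap_length k" "gap_length k \<le> 1" using gap_bounds [OF k] by auto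
      have "\<bar>x\<bar> \<le> 1 / gap_length k"
        using x l gap_length_upper [OF k] by (simp add: pos_le_divide_eq)
          (smt (verit, best) mult_right_mono)
      then have "\<bar>x\<bar> ^ M * (gap_length k / 1) ^ n \<le> (1 / gap_length k) ^ M * 1"
        using l by (intro mult_mono power_mono power_le_one) auto
      then show ?thesis by simp
    qed
    show "\<exists>C N p. \<forall>k\<in>{1..}. \<forall>x\<in>{real k<..<real k + 1}.
        \<forall>y\<in>{gap_start k<..<gap_start k + gap_length k}.
          \<bar>x\<bar> ^ M * (gap_length k / 1) ^ n \<le> C * (\<bar>y\<bar> ^ N + (1 / gap_length k) ^ p)"
      by (intro exI ballI) (rule bound; simp)
  qed
  ultimately have "schwartz_equivalent (interval_union {1..} gap_start gap_length)
      (interval_union {1..} real (\<lambda>_. 1))"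
    by (rule schwartz_equivalent_interval_unions)
  then show ?thesis
    by (simp add: cantor_complement interval_union_def)
qed

end
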